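(* Let $\lambda > 0$ and let $X$ be a homogeneous Poisson point process with intensity $\lambda$ on $[0,\infty)$. Suppose that $w \ge 1$. Let $$M_w := \binom{|X \cap [0,w]|}{2} - |G(X \cap [0,w])|$$ be the number of edges of the Gilbert graph $G(X \cap [0,w])$ that are missing from the complete graph on the vertices $X \cap [0,w]$, and let $p'_0 := \mathbb P(M_w \le 0) = \mathbb P(M_w = 0)$. Then $$p'_0 = e^{-\lambda(w-1)} + (w-1)\lambda e^{-\lambda(w-1)}.$$
   Context: For a finite point set $\varphi \subset \mathbb R$, $|\varphi|$ denotes its number of points. The Gilbert graph $G(\varphi)$ has the points of $\varphi$ as nodes, with an edge between two distinct points $x, y \in \varphi$ if $|x - y| \le 1$. The graph is identified with its edge set, so $|G(\varphi)|$ is the number of edges. $\binom{n}{2} = n(n-1)/2$, which equals $0$ for $n \in \{0,1\}$. *)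

theory Defs
  imports "HOL-Probability.Probability"
begin

definition gilbert_graph :: "real set \<Rightarrow> real set set" where
  "gilbert_graph \<phi> = {{x, y} | x y. x \<in> \<phi> \<and> y \<in> \<phi> \<and> x \<noteq> y \<and> \<bar>x - y\<bar> \<le> 1}"

(* Integer-valued, so that the subtraction is not truncated. *)
definition missing_edges :: "real set \<Rightarrow> int" where
  "missing_edges \<phi> = int (card \<phi> choose 2) - int (card (gilbert_graph \<phi>))"

text \<open>
  A simple point process on a set \<open>S\<close> of reals is a random locally finite subset \<open>X \<omega>\<close> of \<open>S\<close>
  whose counts in bounded Borel subsets of \<open>S\<close> are random variables. It is a homogeneous Poisson
  process with intensity \<open>\<lambda>\<close> if the count in \<open>B\<close> is Poisson distributed with mean \<open>\<lambda>\<close> times the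
  length of \<open>B\<close>, and counts in finitely many pairwise disjoint sets are independent. The Poisson
  weights are written out rather than taken from \<open>poisson_pmf\<close>, because the latter is specified
  only for positive rates, whereas Lebesgue null sets \<open>B\<close> have rate 0 (with \<open>0 ^ 0 = 1\<close>).
\<close>

locale homogeneous_poisson_process = prob_space M
  for M :: "'a measure" and lam :: real and S :: "real set" and X :: "'a \<Rightarrow> real set" +
  assumes points_in: "\<And>\<omega>. \<omega> \<in> space M \<Longrightarrow> X \<omega> \<subseteq> S"
    and locally_finite: "\<And>\<omega> B. \<omega> \<in> space M \<Longrightarrow> bounded B \<Longrightarrow> finite (X \<omega> \<inter> B)"
    and count_measurable: "\<And>B. B \<in> sets borel \<Longrightarrow> bounded B \<Longrightarrow> B \<subseteq> S \<Longrightarrow>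
      (\<lambda>\<omega>. card (X \<omega> \<inter> B)) \<in> measurable M (count_space UNIV)"
    and count_poisson: "\<And>B k. B \<in> sets borel \<Longrightarrow> bounded B \<Longrightarrow> B \<subseteq> S \<Longrightarrow>
      prob {\<omega> \<in> space M. card (X \<omega> \<inter> B) = k} =
        (lam * measure lborel B) ^ k / fact k * exp (- (lam * measure lborel B))"
    and counts_indep: "\<And>(I :: nat set) B. finite I \<Longrightarrow> disjoint_family_on B I \<Longrightarrow>
      (\<And>i. i \<in> I \<Longrightarrow> B i \<in> sets borel \<and> bounded (B i) \<and> B i \<subseteq> S) \<Longrightarrow>
      indep_vars (\<lambda>_. count_space UNIV) (\<lambda>i \<omega>. card (X \<omega> \<inter> B i)) I"

end

theory Submission
  imports Defs "HOL-Real_Asymp.Real_Asymp"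
begin

text \<open>
  Edges are pairs of vertices, so no edge is missing exactly when any two points of
  \<open>X \<inter> [0, w]\<close> are at distance at most 1; call this event \<open>E\<close> and put \<open>h = w - 1\<close>. Heuristically,
  either there is no point in \<open>[0, h)\<close>, which has probability \<open>exp (- \<lambda> h)\<close> and forces \<open>E\<close>
  because \<open>[h, w]\<close> has length 1; or the leftmost point lies in some \<open>[t, t + dt)\<close> with \<open>t < h\<close>,
  and then \<open>E\<close> demands that \<open>(t + 1, w]\<close> be empty. The second possibility contributes
  \<open>exp (- \<lambda> t) * \<lambda> dt * exp (- \<lambda> (h - t)) = \<lambda> exp (- \<lambda> h) dt\<close>, whose integral over \<open>[0, h]\<close>
  is \<open>\<lambda> h exp (- \<lambda> h)\<close>.

  To make this rigorous without conditioning on the leftmost point, let \<open>G t\<close> be the probability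
  that \<open>E\<close> holds and \<open>[0, t)\<close> is empty. For \<open>s \<le> t\<close>, the difference \<open>G s - G t\<close> is the probability
  of an event that lies between two differences of void events, that is, events of the form
  \<open>X \<inter> B = {}\<close>. Void probabilities alone therefore
  give explicit lower and upper bounds for \<open>G s - G t\<close> that depend on \<open>s\<close> and \<open>t\<close> only through \<open>t - s\<close>
  (lemma \<open>clustered_increment\<close>). Adding up \<open>n\<close> increments of length \<open>h / n\<close> and letting \<open>n\<close> tend to
  infinity squeezes \<open>G 0 - G h\<close> to \<open>\<lambda> h exp (- \<lambda> h)\<close>, while \<open>G h = exp (- \<lambda> h)\<close>.
\<close>

section \<open>Missing edges of the Gilbert graph\<close>

definition clustered :: "real set \<Rightarrow> bool" where
  "clustered \<phi> \<longleftrightarrow> (\<forall>x\<in>\<phi>. \<forall>y\<in>\<phi>. \<bar>x - y\<bar> \<le> 1)"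

lemma clustered_if_subset_unit_interval:
  assumes "\<phi> \<subseteq> {a..a + 1}"
  shows "clustered \<phi>"
  unfolding clustered_def
proof (intro ballI)
  fix x y assume "x \<in> \<phi>" "y \<in> \<phi>"
  then have "x \<in> {a..a + 1}" "y \<in> {a..a + 1}"
    using assms by auto
  then show "\<bar>x - y\<bar> \<le> 1"
    by (auto simp: abs_le_iff)
qed

lemma gilbert_graph_subset: "gilbert_graph \<phi> \<subseteq> {e. e \<subseteq> \<phi> \<and> card e = 2}"
  by (auto simp: gilbert_graph_def)

text \<open>
  Since the edge set is contained in the set of two-element subsets, the number of missing edges
  is the size of a set difference.
\<close>

lemma missing_edges_eq_card:
  assumes "finite \<phi>"
  shows "missing_edges \<phi> = int (card ({e. e \<subseteq> \<phi> \<and> card e = 2} - gilbert_graph \<phi>))"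
proof -
  let ?P = "{e. e \<subseteq> \<phi> \<and> card e = 2}"
  have "finite ?P"
    using assms by (auto intro: finite_subset[of _ "Pow \<phi>"])
  then have "finite (gilbert_graph \<phi>)" "card (gilbert_graph \<phi>) \<le> card ?P"
    using gilbert_graph_subset by (auto intro: finite_subset card_mono)
  then have "card (?P - gilbert_graph \<phi>) = card ?P - card (gilbert_graph \<phi>)"
    using gilbert_graph_subset by (intro card_Diff_subset)
  moreover have "card ?P = card \<phi> choose 2"
    using n_subsets[OF assms] .
  ultimately show ?thesis
    using \<open>card (gilbert_graph \<phi>) \<le> card ?P\<close> by (simp add: missing_edges_def of_nat_diff)
qed

lemma missing_edges_nonneg: "finite \<phi> \<Longrightarrow> missing_edges \<phi> \<ge> 0"
  by (simp add: missing_edges_eq_card)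

lemma missing_edges_eq_0_iff:
  assumes "finite \<phi>"
  shows "missing_edges \<phi> = 0 \<longleftrightarrow> clustered \<phi>"
proof -
  let ?P = "{e. e \<subseteq> \<phi> \<and> card e = 2}"
  have "finite ?P"
    using assms by (auto intro: finite_subset[of _ "Pow \<phi>"])
  then have "missing_edges \<phi> = 0 \<longleftrightarrow> ?P \<subseteq> gilbert_graph \<phi>"
    by (simp add: missing_edges_eq_card[OF assms])
  also have "\<dots> \<longleftrightarrow> clustered \<phi>"
  proof
    assume sub: "?P \<subseteq> gilbert_graph \<phi>"
    show "clustered \<phi>"
      unfolding clustered_def
    proof (intro ballI)
      fix x y assume "x \<in> \<phi>" "y \<in> \<phi>"
      show "\<bar>x - y\<bar> \<le> 1"
      proof (cases "x = y")
        case False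
        then have "{x, y} \<in> gilbert_graph \<phi>"
          using sub \<open>x \<in> \<phi>\<close> \<open>y \<in> \<phi>\<close> by auto
        then show ?thesis
          by (auto simp: gilbert_graph_def doubleton_eq_iff abs_minus_commute)
      qed simp
    qed
  next
    assume "clustered \<phi>"
    then show "?P \<subseteq> gilbert_graph \<phi>"
      by (fastforce simp: clustered_def gilbert_graph_def card_2_iff)
  qed
  finally show ?thesis .
qed

section \<open>Void probabilities\<close>

context homogeneous_poisson_process
begin

definition void :: "real set \<Rightarrow> 'a set" where
  "void B = {\<omega> \<in> space M. X \<omega> \<inter> B = {}}"

definition clustered_event :: "real \<Rightarrow> 'a set" where
  "clustered_event w = {\<omega> \<in> space M. clustered (X \<omega> \<inter> {0..w})}"

lemma void_eq_count:
  assumes "bounded B"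
  shows "void B = {\<omega> \<in> space M. card (X \<omega> \<inter> B) = 0}"
  using locally_finite[OF _ assms] by (auto simp: void_def)

lemma void_in_events:
  assumes "B \<in> sets borel" "bounded B" "B \<subseteq> S"
  shows "void B \<in> events"
proof -
  have "(\<lambda>\<omega>. card (X \<omega> \<inter> B)) -` {0} \<inter> space M \<in> events"
    using count_measurable[OF assms] by (rule measurable_sets) simp
  moreover have "(\<lambda>\<omega>. card (X \<omega> \<inter> B)) -` {0} \<inter> space M = void B"
    by (auto simp: void_eq_count[OF assms(2)])
  ultimately show ?thesis by simp
qed

lemma prob_void:
  assumes "B \<in> sets borel" "bounded B" "B \<subseteq> S"
  shows "prob (void B) = exp (- (lam * measure lborel B))"
  using count_poisson[OF assms, of 0] by (simp add: void_eq_count[OF assms(2)])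

text \<open>
  Two points more than 1 apart are separated by a gap \<open>(q, q + 1]\<close> with rational \<open>q\<close>, so
  countably many void events suffice to express clustering.
\<close>

lemma clustered_event_in_events:
  assumes S: "{0..w} \<subseteq> S"
  shows "clustered_event w \<in> events"
proof -
  let ?V = "\<lambda>q. void ({0..w} \<inter> {..q}) \<union> void ({0..w} \<inter> {q + 1<..})"
  have "clustered_event w = space M \<inter> (\<Inter>q\<in>\<rat>. ?V q)"
  proof (intro set_eqI iffI)
    fix \<omega> assume \<omega>: "\<omega> \<in> clustered_event w"
    have "\<omega> \<in> ?V q" for q
    proof (rule ccontr)
      assume "\<omega> \<notin> ?V q"
      then obtain x y where xy: "x \<in> X \<omega> \<inter> {0..w}" "x \<le> q" "y \<in> X \<omega> \<inter> {0..w}" "q + 1 < y"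
        using \<omega> unfolding void_def clustered_event_def by blast
      then have "\<bar>x - y\<bar> \<le> 1"
        using \<omega> unfolding clustered_event_def clustered_def by blast
      with xy show False by linarith
    qed
    then show "\<omega> \<in> space M \<inter> (\<Inter>q\<in>\<rat>. ?V q)"
      using \<omega> by (auto simp: clustered_event_def)
  next
    fix \<omega> assume \<omega>: "\<omega> \<in> space M \<inter> (\<Inter>q\<in>\<rat>. ?V q)"
    have le: "y - x \<le> 1" if "x \<in> X \<omega> \<inter> {0..w}" "y \<in> X \<omega> \<inter> {0..w}" for x y
    proof (rule ccontr)
      assume "\<not> y - x \<le> 1"
      then obtain q where "q \<in> \<rat>" "x < q" "q < y - 1"
        using Rats_dense_in_real[of x "y - 1"] by auto
      then have "\<omega> \<in> ?V q" "x \<le> q" "q + 1 < y"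
        using \<omega> by auto
      then show False
        using that by (auto simp: void_def)
    qed
    then have "\<bar>x - y\<bar> \<le> 1" if "x \<in> X \<omega> \<inter> {0..w}" "y \<in> X \<omega> \<inter> {0..w}" for x y
      using le[OF that] le[OF that(2,1)] by (simp add: abs_le_iff)
    then show "\<omega> \<in> clustered_event w"
      using \<omega> unfolding clustered_event_def clustered_def by blast
  qed
  moreover have "void ({0..w} \<inter> B) \<in> events" if "B \<in> sets borel" for B
    using S that by (intro void_in_events) (auto intro: bounded_subset[of "{0..w}"])
  then have "?V q \<in> events" for q
    by (intro sets.Un) (blast intro: borel_closed borel_open closed_atMost open_greaterThan)+
  then have "(\<Inter>q\<in>\<rat>. ?V q) \<in> events"
    using Rats_0 by (intro sets.countable_INT' countable_rat) blast+
  then have "space M \<inter> (\<Inter>q\<in>\<rat>. ?V q) \<in> events"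
    by (intro sets.Int sets.top)
  ultimately show ?thesis by simp
qed

text \<open>
  Clustering with leftmost point near \<open>a\<close> means roughly that \<open>[0, a)\<close> and \<open>(a + 1, w]\<close> are empty,
  so sets of this shape serve for the comparison.
\<close>

lemma two_sided_void:
  assumes S: "{0..w} \<subseteq> S" and "0 \<le> a" "a \<le> b" "b \<le> w"
  shows "void ({0..<a} \<union> {b<..w}) \<in> events"
    and "prob (void ({0..<a} \<union> {b<..w})) = exp (- (lam * (a + (w - b))))"
proof -
  let ?B = "{0..<a} \<union> {b<..w}"
  have B: "?B \<in> sets borel" "bounded ?B" "?B \<subseteq> S"
    using assms by (auto intro: bounded_subset[of "{0..w}"])
  show "void ?B \<in> events"
    by (rule void_in_events[OF B])
  have "measure lborel ?B = measure lborel {0..<a} + measure lborel {b<..w}"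
    using assms by (intro measure_Union) auto
  also have "\<dots> = a + (w - b)"
    using assms by simp
  finally show "prob (void ?B) = exp (- (lam * (a + (w - b))))"
    using prob_void[OF B] by simp
qed

lemma prob_two_sided_void_Diff:
  assumes "{0..w} \<subseteq> S" "0 \<le> s" "s \<le> t" "t \<le> b" "b \<le> w"
  shows "prob (void ({0..<s} \<union> {b<..w}) - void ({0..<t} \<union> {b<..w})) =
    exp (- (lam * (s + (w - b)))) - exp (- (lam * (t + (w - b))))"
proof -
  have "void ({0..<t} \<union> {b<..w}) \<subseteq> void ({0..<s} \<union> {b<..w})"
    using assms by (auto simp: void_def)
  then show ?thesis
    using assms by (subst finite_measure_Diff) (auto simp: two_sided_void)
qed

section \<open>The probability of clustering\<close>

definition clustered_after :: "real \<Rightarrow> real \<Rightarrow> real" where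
  "clustered_after w t = prob (clustered_event w \<inter> void {0..<t})"

lemma void_initial_in_events:
  assumes "{0..w} \<subseteq> S" "0 \<le> t" "t \<le> w"
  shows "void {0..<t} \<in> events"
  using two_sided_void(1)[of w t w] assms by simp

text \<open>
  If the leftmost point \<open>x\<close> lies in \<open>[s, t)\<close>, then clustering is the same as \<open>(x + 1, w]\<close> being
  empty. It therefore forces \<open>(t + 1, w]\<close> to be empty, and emptiness of \<open>(s + 1, w]\<close> suffices for
  it. The bound \<open>t \<le> s + 1\<close>
  keeps \<open>[0, t)\<close> and \<open>(s + 1, w]\<close> disjoint, so that their lengths add up.
\<close>

lemma clustered_increment:
  assumes S: "{0..w} \<subseteq> S" and "0 \<le> s" "s \<le> t" "t \<le> w - 1" "t \<le> s + 1"
  defines "c \<equiv> exp (- (lam * (w - 1)))"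
  shows "c * (1 - exp (- (lam * (t - s)))) \<le> clustered_after w s - clustered_after w t"
    and "clustered_after w s - clustered_after w t \<le> c * (exp (lam * (t - s)) - 1)"
proof -
  let ?E = "clustered_event w"
  let ?D = "?E \<inter> void {0..<s} - ?E \<inter> void {0..<t}"
  let ?L = "void ({0..<s} \<union> {s + 1<..w}) - void ({0..<t} \<union> {s + 1<..w})"
  let ?U = "void ({0..<s} \<union> {t + 1<..w}) - void ({0..<t} \<union> {t + 1<..w})"
  have ev: "?E \<inter> void {0..<s} \<in> events" "?E \<inter> void {0..<t} \<in> events"
    using assms by (auto intro!: sets.Int clustered_event_in_events void_initial_in_events[of w])
  have "?E \<inter> void {0..<t} \<subseteq> ?E \<inter> void {0..<s}"
    using assms by (auto simp: void_def)
  then have D: "clustered_after w s - clustered_after w t = prob ?D"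
    using ev by (simp add: clustered_after_def finite_measure_Diff)

  have "?L \<subseteq> ?D"
  proof
    fix \<omega> assume \<omega>: "\<omega> \<in> ?L"
    have "X \<omega> \<inter> {0..w} \<subseteq> {s..s + 1}"
    proof
      fix x assume x: "x \<in> X \<omega> \<inter> {0..w}"
      with \<omega> have "x \<notin> {0..<s} \<union> {s + 1<..w}"
        unfolding void_def by blast
      with x show "x \<in> {s..s + 1}" by auto
    qed
    then have "clustered (X \<omega> \<inter> {0..w})"
      by (rule clustered_if_subset_unit_interval)
    then show "\<omega> \<in> ?D"
      using \<omega> by (auto simp: void_def clustered_event_def)
  qed
  then have "prob ?L \<le> prob ?D"
    using ev by (intro finite_measure_mono) auto
  also have "prob ?L = c * (1 - exp (- (lam * (t - s))))"
    using assms
    by (subst prob_two_sided_void_Diff) (auto simp: algebra_simps simp flip: exp_add)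
  finally show "c * (1 - exp (- (lam * (t - s)))) \<le> clustered_after w s - clustered_after w t"
    using D by simp

  have "?D \<subseteq> ?U"
  proof
    fix \<omega> assume \<omega>: "\<omega> \<in> ?D"
    then obtain x where x: "x \<in> X \<omega>" "0 \<le> x" "x < t"
      by (auto simp: void_def)
    have "y \<le> t + 1" if "y \<in> X \<omega> \<inter> {0..w}" for y
    proof -
      have "x \<in> X \<omega> \<inter> {0..w}"
        using x assms by auto
      then have "\<bar>x - y\<bar> \<le> 1"
        using \<omega> that by (auto simp: clustered_event_def clustered_def)
      with x show ?thesis by linarith
    qed
    then have "X \<omega> \<inter> {t + 1<..w} = {}"
      using assms by fastforce
    then show "\<omega> \<in> ?U"
      using \<omega> by (auto simp: void_def)
  qed
  moreover have "?U \<in> events"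
    using assms by (intro sets.Diff two_sided_void) auto
  ultimately have "prob ?D \<le> prob ?U"
    by (intro finite_measure_mono) auto
  also have "prob ?U = c * (exp (lam * (t - s)) - 1)"
    using assms
    by (subst prob_two_sided_void_Diff) (auto simp: algebra_simps simp flip: exp_add)
  finally show "clustered_after w s - clustered_after w t \<le> c * (exp (lam * (t - s)) - 1)"
    using D by simp
qed

text \<open>
  If \<open>[0, w - 1)\<close> is empty, the remaining window has length 1 and clustering is automatic.
\<close>

lemma clustered_after_end:
  assumes "{0..w} \<subseteq> S" "1 \<le> w"
  shows "clustered_after w (w - 1) = exp (- (lam * (w - 1)))"
proof -
  have "\<omega> \<in> clustered_event w" if "\<omega> \<in> void {0..<w - 1}" for \<omega>
  proof -
    have "X \<omega> \<inter> {0..w} \<subseteq> {w - 1..w - 1 + 1}"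
      using that by (fastforce simp: void_def)
    then have "clustered (X \<omega> \<inter> {0..w})"
      by (rule clustered_if_subset_unit_interval)
    then show ?thesis
      using that by (auto simp: void_def clustered_event_def)
  qed
  then have "clustered_event w \<inter> void {0..<w - 1} = void {0..<w - 1}"
    by auto
  then show ?thesis
    using two_sided_void(2)[of w "w - 1" w] assms by (simp add: clustered_after_def)
qed

text \<open>
  The increments over a partition of \<open>[0, w - 1]\<close> into \<open>n\<close> equal parts telescope, and both the sum
  of the lower bounds and the sum of the upper bounds tend to
  \<open>lam * (w - 1) * exp (- (lam * (w - 1)))\<close>.
\<close>

theorem prob_clustered_event:
  assumes S: "{0..w} \<subseteq> S" and w: "1 \<le> w"
  shows "prob (clustered_event w) =
    exp (- (lam * (w - 1))) + lam * (w - 1) * exp (- (lam * (w - 1)))"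
proof -
  define h where "h = w - 1"
  define c where "c = exp (- (lam * h))"
  define G where "G = clustered_after w"
  have h: "0 \<le> h" using w by (simp add: h_def)

  have bounds: "real n * (c * (1 - exp (- (lam * (h / real n))))) \<le> G 0 - G h \<and>
      G 0 - G h \<le> real n * (c * (exp (lam * (h / real n)) - 1))"
    if n: "n > 0" "h \<le> real n" for n :: nat
  proof -
    define t where "t i = real i * (h / real n)" for i :: nat
    have step: "t (Suc i) - t i = h / real n" for i
      by (simp add: t_def algebra_simps add_divide_distrib)
    have ends: "t 0 = 0" "t n = h"
      using n by (auto simp: t_def)
    have inc: "c * (1 - exp (- (lam * (h / real n)))) \<le> G (t i) - G (t (Suc i)) \<and>
        G (t i) - G (t (Suc i)) \<le> c * (exp (lam * (h / real n)) - 1)" if "i < n" for i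
    proof -
      have "real (Suc i) * h \<le> real n * h"
        using that h by (intro mult_right_mono) auto
      then have "t (Suc i) \<le> w - 1"
        using n by (simp add: t_def h_def[symmetric] field_simps)
      moreover have "0 \<le> t i"
        using h by (simp add: t_def)
      moreover have "0 \<le> h / real n"
        using h by simp
      then have "t i \<le> t (Suc i)"
        using step[of i] by linarith
      moreover have "h / real n \<le> 1"
        using n by simp
      then have "t (Suc i) \<le> t i + 1"
        using step[of i] by linarith
      ultimately show ?thesis
        using clustered_increment[OF S, of "t i" "t (Suc i)"]
        unfolding step c_def h_def G_def by blast
    qed
    have "(\<Sum>i<n. G (t i) - G (t (Suc i))) = G 0 - G h"
      using sum_lessThan_telescope'[of "\<lambda>i. G (t i)" n] ends by simp
    moreover have "(\<Sum>i<n. c * (1 - exp (- (lam * (h / real n))))) \<le>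
        (\<Sum>i<n. G (t i) - G (t (Suc i)))"
      using inc by (intro sum_mono) auto
    moreover have "(\<Sum>i<n. G (t i) - G (t (Suc i))) \<le>
        (\<Sum>i<n. c * (exp (lam * (h / real n)) - 1))"
      using inc by (intro sum_mono) auto
    ultimately show ?thesis by simp
  qed

  have ev: "\<forall>\<^sub>F n in sequentially. n > 0 \<and> h \<le> real n"
    by (intro eventually_conj eventually_gt_at_top) real_asymp
  have "(\<lambda>n. real n * (c * (1 - exp (- (lam * (h / real n)))))) \<longlonglongrightarrow> c * (lam * h)"
    by real_asymp
  then have "c * (lam * h) \<le> G 0 - G h"
    using ev bounds by (intro tendsto_upperbound) (auto elim!: eventually_mono)
  moreover have "(\<lambda>n. real n * (c * (exp (lam * (h / real n)) - 1))) \<longlonglongrightarrow> c * (lam * h)"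
    by real_asymp
  then have "G 0 - G h \<le> c * (lam * h)"
    using ev bounds by (intro tendsto_lowerbound) (auto elim!: eventually_mono)
  ultimately have "G 0 = G h + c * (lam * h)"
    by simp
  moreover have "clustered_event w \<inter> void {0..<0} = clustered_event w"
    by (auto simp: clustered_event_def void_def)
  then have "G 0 = prob (clustered_event w)"
    by (simp add: G_def clustered_after_def)
  moreover have "G h = c"
    using clustered_after_end[OF S w] by (simp add: G_def h_def c_def)
  ultimately show ?thesis
    by (simp add: c_def h_def mult_ac)
qed

end

theorem theorem4:
  fixes M :: "'a measure" and lam w :: real and X :: "'a \<Rightarrow> real set"
  assumes "lam > 0"
    and "homogeneous_poisson_process M lam {0..} X"
    and "w \<ge> 1"
  shows "measure M {\<omega> \<in> space M. missing_edges (X \<omega> \<inter> {0..w}) \<le> 0} =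
           measure M {\<omega> \<in> space M. missing_edges (X \<omega> \<inter> {0..w}) = 0} \<and>
         measure M {\<omega> \<in> space M. missing_edges (X \<omega> \<inter> {0..w}) \<le> 0} =
           exp (- lam * (w - 1)) + (w - 1) * lam * exp (- lam * (w - 1))"
proof -
  interpret homogeneous_poisson_process M lam "{0..}" X
    by fact
  have fin: "finite (X \<omega> \<inter> {0..w})" if "\<omega> \<in> space M" for \<omega>
    using locally_finite[OF that] by simp
  have eq: "{\<omega> \<in> space M. missing_edges (X \<omega> \<inter> {0..w}) \<le> 0} =
      {\<omega> \<in> space M. missing_edges (X \<omega> \<inter> {0..w}) = 0}"
    using missing_edges_nonneg[OF fin] by (auto intro: antisym)
  also have "\<dots> = clustered_event w"
    using missing_edges_eq_0_iff[OF fin] by (auto simp: clustered_event_def)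
  finally show ?thesis
    using eq prob_clustered_event[of w] \<open>w \<ge> 1\<close> by (simp add: mult_ac)
qed

end
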